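(* For the rank-$R$ separable ansatz $u_\theta(z)=\sum_{\alpha=1}^R\prod_{m=1}^du_m^\alpha(z_m;\theta^m)$ and each operator pair $(\beta,\gamma)$, define the univariate cross-Gram matrices $\mathsf H_m^{(\beta,\gamma)}:=\frac1{n_m}(\mathsf F_m^{(\beta)})^\top\mathsf F_m^{(\gamma)}\in\mathbb R^{R\times R}$ and the Hadamard products $$\mathsf H_{-s}^{(\beta,\gamma)}:=\mathop{\bigcirc}_{m\ne s}\mathsf H_m^{(\beta,\gamma)},\qquad \mathsf H_{-st}^{(\beta,\gamma)}:=\mathop{\bigcirc}_{m\ne s,t}\mathsf H_m^{(\beta,\gamma)}.$$ Then the compressed Gramian blocks $\Upsilon_{st}^{(\beta,\gamma)}=\frac1{N_{\mathcal D}}(\Psi_s^{(\beta)})^\top\Psi_t^{(\gamma)}$ satisfy: (1) For $s=t$: $\ \Upsilon_{ss}^{(\beta,\gamma)}=\frac1{n_s}I_{n_s}\otimes\mathsf H_{-s}^{(\beta,\gamma)}\in\mathbb R^{n_sR\times n_sR}$. (2) For $s<t$, the $(i_s,i_t)$ block of size $R\times R$ (rows $\overline{i_s\alpha}$, $\alpha=1,\dots,R$, and columns $\overline{i_t\alpha'}$, $\alpha'=1,\dots,R$) is $$\Upsilon_{st}^{(\beta,\gamma)}(\overline{i_s:},\overline{i_t:})=\frac1{n_sn_t}\operatorname{Diag}\big(\mathsf F_t^{(\beta)}(i_t,:)\big)\,\mathsf H_{-st}^{(\beta,\gamma)}\,\operatorname{Diag}\big(\mathsf F_s^{(\gamma)}(i_s,:)\big),$$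 and the opposite block is given by $\Upsilon_{ts}^{(\gamma,\beta)}=(\Upsilon_{st}^{(\beta,\gamma)})^\top$.
   Context: $\mathcal D=\mathcal D_1\times\cdots\times\mathcal D_d$ with bounded open intervals $\mathcal D_m$; $H_m\hookrightarrow L^2(\mathcal D_m)$ are Hilbert spaces, $u_m^\alpha(\cdot;\theta^m)\in H_m$ ($\alpha=1,\dots,R$) are univariate network factors, and $\mathcal A_m^{(\beta)}:H_m\to L^2(\mathcal D_m)$ ($\beta=1,\dots,R_{\mathcal A}$) are the bounded linear factors of a separable operator $\mathcal A=\sum_{\beta=1}^{R_{\mathcal A}}\mathcal A_1^{(\beta)}\otimes\cdots\otimes\mathcal A_d^{(\beta)}$ on $H_1\otimes\cdots\otimes H_d$; the functions $\mathcal A_m^{(\beta)}u_m^\alpha$ have continuous representatives so that they can be evaluated at points. Factor grids: $\mathcal X_m=\{z_{m,1},\dots,z_{m,n_m}\}\subset\mathcal D_m$, $N_{\mathcal D}=\prod_mn_m$. Index convention: $\overline{i_1\ldots i_k}=i_k+(i_{k-1}-1)n_k+\cdots+(i_1-1)n_2\cdots n_k$ (lexicographic, leftmost index slowest), and $(A\otimes B)(\overline{i_1i_2},\overline{j_1j_2})=A(i_1,j_1)B(i_2,j_2)$ for the Kronecker product. $\circ$ is the Hadamard (entrywise) product; an empty Hadamard product is the $R\times R$ all-ones matrix. $\operatorname{Diag}(v)$ is the diagonal matrix with diagonal $v$. Operated factor matrices: $\mathsf F_m^{(\beta)}\in\mathbb R^{n_m\times R}$, $\mathsf F_m^{(\beta)}(i_m,\alpha)=(\mathcal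 A_m^{(\beta)}u_m^\alpha)(z_{m,i_m})$. Inactive contractions: $\mathsf E_s^{(\beta)}(\overline{i_{-s}},\alpha)=\prod_{m\ne s}\mathsf F_m^{(\beta)}(i_m,\alpha)$, where $i_{-s}$ is $(i_1,\dots,i_d)$ with $i_s$ removed. Direction matrices: $\Psi_s^{(\beta)}\in\mathbb R^{N_{\mathcal D}\times n_sR}$, $\Psi_s^{(\beta)}(\overline{i_1\ldots i_d},\overline{j_s\alpha})=\delta_{i_sj_s}\mathsf E_s^{(\beta)}(\overline{i_{-s}},\alpha)$. *)

theory Defs
  imports "HOL-Analysis.Lebesgue_Measure" "Jordan_Normal_Form.Matrix"
begin

text \<open>
  All indices are 0-based: factors \<open>m < d\<close>, ranks \<open>\<alpha> < R\<close>, operator terms \<open>\<beta> < RA\<close>, grid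
  points \<open>i < n m\<close>, and rows and columns of matrices.
\<close>

text \<open>
  Elements of \<open>L\<^sup>2(D)\<close>, and of the spaces embedded in it, are represented by functions on the
  real line whose values off \<open>D\<close> are irrelevant; equality in these spaces is equality almost
  everywhere on \<open>D\<close>.
\<close>

definition L2_on :: "real set \<Rightarrow> (real \<Rightarrow> real) set" where
  "L2_on D = {f \<in> borel_measurable (lebesgue_on D). integrable (lebesgue_on D) (\<lambda>x. (f x)\<^sup>2)}"

definition L2_norm :: "real set \<Rightarrow> (real \<Rightarrow> real) \<Rightarrow> real" where
  "L2_norm D f = sqrt (\<integral>x. (f x)\<^sup>2 \<partial>lebesgue_on D)"

text \<open>
  \<open>H\<close> with inner product \<open>ip\<close> is a real Hilbert space, continuously embedded in \<open>L\<^sup>2(D)\<close>.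
\<close>

definition hilbert_embedded_L2 ::
  "real set \<Rightarrow> (real \<Rightarrow> real) set \<Rightarrow> ((real \<Rightarrow> real) \<Rightarrow> (real \<Rightarrow> real) \<Rightarrow> real) \<Rightarrow> bool" where
  "hilbert_embedded_L2 D H ip \<longleftrightarrow>
     H \<subseteq> L2_on D \<and>
     (\<lambda>x. 0) \<in> H \<and>
     (\<forall>f\<in>H. \<forall>g\<in>H. (\<lambda>x. f x + g x) \<in> H) \<and>
     (\<forall>c. \<forall>f\<in>H. (\<lambda>x. c * f x) \<in> H) \<and>
     (\<forall>f\<in>H. \<forall>g\<in>L2_on D. (AE x in lebesgue_on D. f x = g x) \<longrightarrow> g \<in> H) \<and>
     (\<forall>f\<in>H. \<forall>g\<in>H. ip f g = ip g f) \<and>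
     (\<forall>f\<in>H. \<forall>g\<in>H. \<forall>h\<in>H. ip (\<lambda>x. f x + g x) h = ip f h + ip g h) \<and>
     (\<forall>c. \<forall>f\<in>H. \<forall>g\<in>H. ip (\<lambda>x. c * f x) g = c * ip f g) \<and>
     (\<forall>f\<in>H. 0 \<le> ip f f) \<and>
     (\<forall>f\<in>H. ip f f = 0 \<longleftrightarrow> (AE x in lebesgue_on D. f x = 0)) \<and>
     (\<forall>X. (\<forall>k. X k \<in> H) \<and>
          (\<forall>e>0. \<exists>N. \<forall>j\<ge>N. \<forall>k\<ge>N. ip (\<lambda>x. X j x - X k x) (\<lambda>x. X j x - X k x) < e)
        \<longrightarrow> (\<exists>f\<in>H. (\<lambda>k. ip (\<lambda>x. X k x - f x) (\<lambda>x. X k x - f x)) \<longlonglongrightarrow> 0)) \<and>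
     (\<exists>C. \<forall>f\<in>H. L2_norm D f \<le> C * sqrt (ip f f))"

definition bounded_linear_to_L2 ::
  "real set \<Rightarrow> (real \<Rightarrow> real) set \<Rightarrow> ((real \<Rightarrow> real) \<Rightarrow> (real \<Rightarrow> real) \<Rightarrow> real)
     \<Rightarrow> ((real \<Rightarrow> real) \<Rightarrow> (real \<Rightarrow> real)) \<Rightarrow> bool" where
  "bounded_linear_to_L2 D H ip T \<longleftrightarrow>
     (\<forall>f\<in>H. T f \<in> L2_on D) \<and>
     (\<forall>f\<in>H. \<forall>g\<in>H. AE x in lebesgue_on D. T (\<lambda>y. f y + g y) x = T f x + T g x) \<and>
     (\<forall>c. \<forall>f\<in>H. AE x in lebesgue_on D. T (\<lambda>y. c * f y) x = c * T f x) \<and>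
     (\<exists>C. \<forall>f\<in>H. L2_norm D (T f) \<le> C * sqrt (ip f f))"

definition is_cont_rep :: "real set \<Rightarrow> (real \<Rightarrow> real) \<Rightarrow> (real \<Rightarrow> real) \<Rightarrow> bool" where
  "is_cont_rep D f g \<longleftrightarrow> continuous_on D g \<and> (AE x in lebesgue_on D. f x = g x)"

text \<open>On an open set \<open>D\<close> the continuous representative is unique, so the choice is harmless there.\<close>

definition cont_rep :: "real set \<Rightarrow> (real \<Rightarrow> real) \<Rightarrow> real \<Rightarrow> real" where
  "cont_rep D f = (SOME g. is_cont_rep D f g)"

definition elem_tensor :: "nat \<Rightarrow> (nat \<Rightarrow> real \<Rightarrow> real) \<Rightarrow> (nat \<Rightarrow> real) \<Rightarrow> real" where
  "elem_tensor d f z = (\<Prod>m<d. f m (z m))"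

definition separable_ansatz ::
  "nat \<Rightarrow> nat \<Rightarrow> (nat \<Rightarrow> nat \<Rightarrow> 'p \<Rightarrow> real \<Rightarrow> real) \<Rightarrow> (nat \<Rightarrow> 'p) \<Rightarrow> (nat \<Rightarrow> real) \<Rightarrow> real" where
  "separable_ansatz d R u \<theta> z = (\<Sum>\<alpha><R. elem_tensor d (\<lambda>m. u m \<alpha> (\<theta> m)) z)"

text \<open>
  \<open>\<A>\<close> equals \<open>\<Sum>\<^sub>\<beta> A\<^sub>0\<^sup>\<beta> \<otimes> \<dots> \<otimes> A\<^sub>d\<^sub>-\<^sub>1\<^sup>\<beta>\<close> on finite sums of elementary tensors from the spaces \<open>H m\<close>,
  which are dense in the Hilbert space tensor product. Stating the identity on such sums, rather
  than on single tensors, includes the linearity of \<open>\<A>\<close> on them.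
\<close>

definition separable_operator ::
  "nat \<Rightarrow> nat \<Rightarrow> (nat \<Rightarrow> real set) \<Rightarrow> (nat \<Rightarrow> (real \<Rightarrow> real) set)
     \<Rightarrow> (nat \<Rightarrow> nat \<Rightarrow> (real \<Rightarrow> real) \<Rightarrow> (real \<Rightarrow> real))
     \<Rightarrow> (((nat \<Rightarrow> real) \<Rightarrow> real) \<Rightarrow> ((nat \<Rightarrow> real) \<Rightarrow> real)) \<Rightarrow> bool" where
  "separable_operator d RA D H A \<A> \<longleftrightarrow>
     (\<forall>K f. (\<forall>k<K. \<forall>m<d. f k m \<in> H m) \<longrightarrow>
        (AE z in (\<Pi>\<^sub>M m\<in>{..<d}. lebesgue_on (D m)).
           \<A> (\<lambda>y. \<Sum>k<(K::nat). elem_tensor d (f k) y) z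
             = (\<Sum>k<K. \<Sum>\<beta><RA. elem_tensor d (\<lambda>m. A m \<beta> (f k m)) z)))"

definition multi_indices :: "nat list \<Rightarrow> nat list set" where
  "multi_indices ns = {is. length is = length ns \<and> (\<forall>k<length ns. is ! k < ns ! k)}"

text \<open>The 0-based form of \<open>i\<^sub>k + (i\<^sub>k\<^sub>-\<^sub>1 - 1) n\<^sub>k + \<dots> + (i\<^sub>1 - 1) n\<^sub>2 \<dots> n\<^sub>k\<close>, leftmost index slowest.\<close>

definition lex_index :: "nat list \<Rightarrow> nat list \<Rightarrow> nat" where
  "lex_index ns is = (\<Sum>k<length ns. is ! k * prod_list (drop (Suc k) ns))"

definition lex_decode :: "nat list \<Rightarrow> nat \<Rightarrow> nat list" where
  "lex_decode ns = the_inv_into (multi_indices ns) (lex_index ns)"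

text \<open>
  The matrix with entry \<open>f is js\<close> in row \<open>lex_index rs is\<close> and column \<open>lex_index cs js\<close>; see
  \<open>index_lex_mat\<close> below.
\<close>

definition lex_mat :: "nat list \<Rightarrow> nat list \<Rightarrow> (nat list \<Rightarrow> nat list \<Rightarrow> 'a) \<Rightarrow> 'a mat" where
  "lex_mat rs cs f =
     mat (prod_list rs) (prod_list cs) (\<lambda>(p, q). f (lex_decode rs p) (lex_decode cs q))"

lemma lex_index_Cons:
  "lex_index (n # ns) (i # is) = i * prod_list ns + lex_index ns is"
  unfolding lex_index_def by (simp add: sum.lessThan_Suc_shift del: sum.lessThan_Suc)

lemma multi_indices_Nil: "multi_indices [] = {[]}"
  by (auto simp: multi_indices_def)

lemma multi_indices_Cons:
  "multi_indices (n # ns) = {i # is |i is. i < n \<and> is \<in> multi_indices ns}"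
proof (intro equalityI subsetI)
  fix xs assume "xs \<in> multi_indices (n # ns)"
  then have l: "length xs = Suc (length ns)"
    and b: "\<And>k. k < Suc (length ns) \<Longrightarrow> xs ! k < (n # ns) ! k"
    by (auto simp: multi_indices_def)
  obtain i js where xs: "xs = i # js" using l by (cases xs) auto
  have "i < n" using b[of 0] xs by simp
  moreover have "js \<in> multi_indices ns"
    using l b[of "Suc k" for k] xs by (auto simp: multi_indices_def)
  ultimately show "xs \<in> {i # is |i is. i < n \<and> is \<in> multi_indices ns}" using xs by blast
next
  fix xs assume "xs \<in> {i # is |i is. i < n \<and> is \<in> multi_indices ns}"
  then show "xs \<in> multi_indices (n # ns)"
    by (auto simp: multi_indices_def nth_Cons split: nat.split)
qed

lemma lex_index_less: "is \<in> multi_indices ns \<Longrightarrow> lex_index ns is < prod_list ns"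
proof (induction ns arbitrary: "is")
  case Nil
  then show ?case by (simp add: multi_indices_Nil lex_index_def)
next
  case (Cons n ns)
  then obtain i js where e: "is = i # js" "i < n" "js \<in> multi_indices ns"
    by (auto simp: multi_indices_Cons)
  have "lex_index (n # ns) is < i * prod_list ns + prod_list ns"
    using Cons.IH[OF e(3)] e(1) by (simp add: lex_index_Cons)
  also have "\<dots> = Suc i * prod_list ns" by simp
  also have "\<dots> \<le> n * prod_list ns" using e(2) by (intro mult_right_mono) auto
  finally show ?case by simp
qed

lemma inj_on_lex_index: "inj_on (lex_index ns) (multi_indices ns)"
proof (induction ns)
  case Nil
  then show ?case by (simp add: multi_indices_Nil)
next
  case (Cons n ns)
  show ?case
  proof (rule inj_onI)
    fix xs ys
    assume "xs \<in> multi_indices (n # ns)" "ys \<in> multi_indices (n # ns)"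
      and eq: "lex_index (n # ns) xs = lex_index (n # ns) ys"
    then obtain i xs' j ys' where e: "xs = i # xs'" "xs' \<in> multi_indices ns"
        "ys = j # ys'" "ys' \<in> multi_indices ns"
      by (auto simp: multi_indices_Cons)
    let ?P = "prod_list ns"
    have l: "lex_index ns xs' < ?P" "lex_index ns ys' < ?P"
      using e lex_index_less by auto
    have h: "i * ?P + lex_index ns xs' = j * ?P + lex_index ns ys'"
      using eq e by (simp add: lex_index_Cons)
    have "i = (i * ?P + lex_index ns xs') div ?P" using l(1) by (simp add: div_add1_eq)
    also have "\<dots> = j" unfolding h using l(2) by (simp add: div_add1_eq)
    finally have "i = j" .
    with h have "lex_index ns xs' = lex_index ns ys'" by simp
    then have "xs' = ys'" using Cons.IH e by (auto dest: inj_onD)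
    then show "xs = ys" using \<open>i = j\<close> e by simp
  qed
qed

lemma lex_index_surj: "p < prod_list ns \<Longrightarrow> \<exists>is\<in>multi_indices ns. lex_index ns is = p"
proof (induction ns arbitrary: p)
  case Nil
  then show ?case by (simp add: multi_indices_Nil lex_index_def)
next
  case (Cons n ns)
  let ?P = "prod_list ns"
  have pos: "0 < ?P" using Cons.prems by (cases "?P = 0") auto
  obtain js where js: "js \<in> multi_indices ns" "lex_index ns js = p mod ?P"
    using Cons.IH[of "p mod ?P"] pos by auto
  have "p div ?P < n" using Cons.prems pos by (simp add: less_mult_imp_div_less)
  then have "(p div ?P) # js \<in> multi_indices (n # ns)" using js by (auto simp: multi_indices_Cons)
  moreover have "lex_index (n # ns) ((p div ?P) # js) = p" using js by (simp add: lex_index_Cons)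
  ultimately show ?case by blast
qed

lemma bij_betw_lex_index: "bij_betw (lex_index ns) (multi_indices ns) {..<prod_list ns}"
  unfolding bij_betw_def using inj_on_lex_index lex_index_less lex_index_surj by fastforce

lemma index_lex_mat:
  assumes "is \<in> multi_indices rs" "js \<in> multi_indices cs"
  shows "lex_mat rs cs f $$ (lex_index rs is, lex_index cs js) = f is js"
  using assms
  by (simp add: lex_mat_def lex_index_less lex_decode_def the_inv_into_f_f inj_on_lex_index)

definition kron :: "'a::times mat \<Rightarrow> 'a mat \<Rightarrow> 'a mat" (infixl "\<otimes>\<^sub>K" 70) where
  "A \<otimes>\<^sub>K B = lex_mat [dim_row A, dim_row B] [dim_col A, dim_col B]
     (\<lambda>is js. A $$ (is ! 0, js ! 0) * B $$ (is ! 1, js ! 1))"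

definition hadamard_prod :: "nat \<Rightarrow> nat set \<Rightarrow> (nat \<Rightarrow> real mat) \<Rightarrow> real mat" where
  "hadamard_prod R S M = mat R R (\<lambda>(\<alpha>, \<alpha>'). \<Prod>m\<in>S. M m $$ (\<alpha>, \<alpha>'))"

definition Diag :: "'a::zero Matrix.vec \<Rightarrow> 'a mat" where
  "Diag v = mat_diag (dim_vec v) (vec_index v)"

text \<open>
  The \<open>R \<times> R\<close> block of \<open>M\<close> with rows \<open>(i, \<alpha>)\<close> and columns \<open>(j, \<alpha>')\<close>, where the row and column
  sets of \<open>M\<close> are indexed lexicographically by \<open>a \<times> R\<close> and \<open>b \<times> R\<close>.
\<close>

definition rank_block :: "nat \<Rightarrow> nat \<Rightarrow> nat \<Rightarrow> 'a mat \<Rightarrow> nat \<Rightarrow> nat \<Rightarrow> 'a mat" where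
  "rank_block a b R M i j =
     mat R R (\<lambda>(\<alpha>, \<alpha>'). M $$ (lex_index [a, R] [i, \<alpha>], lex_index [b, R] [j, \<alpha>']))"

definition remove_nth :: "nat \<Rightarrow> 'a list \<Rightarrow> 'a list" where
  "remove_nth s xs = take s xs @ drop (Suc s) xs"

definition grid_dims :: "nat \<Rightarrow> (nat \<Rightarrow> nat) \<Rightarrow> nat list" where
  "grid_dims d n = map n [0..<d]"

definition grid_size :: "nat \<Rightarrow> (nat \<Rightarrow> nat) \<Rightarrow> nat" where
  "grid_size d n = (\<Prod>m<d. n m)"

definition factor_mat ::
  "(nat \<Rightarrow> real set) \<Rightarrow> (nat \<Rightarrow> nat) \<Rightarrow> nat \<Rightarrow> (nat \<Rightarrow> nat \<Rightarrow> real)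
     \<Rightarrow> (nat \<Rightarrow> nat \<Rightarrow> (real \<Rightarrow> real) \<Rightarrow> (real \<Rightarrow> real)) \<Rightarrow> (nat \<Rightarrow> nat \<Rightarrow> 'p \<Rightarrow> real \<Rightarrow> real)
     \<Rightarrow> (nat \<Rightarrow> 'p) \<Rightarrow> nat \<Rightarrow> nat \<Rightarrow> real mat" where
  "factor_mat D n R z A u \<theta> m \<beta> =
     mat (n m) R (\<lambda>(i, \<alpha>). cont_rep (D m) (A m \<beta> (u m \<alpha> (\<theta> m))) (z m i))"

text \<open>
  In the following, \<open>F m \<beta>\<close> is the factor matrix of the operator factor \<open>A m \<beta>\<close>. The list \<open>is\<close>
  indexing a row of \<open>inactive_mat\<close> omits position \<open>s\<close>, so that factors \<open>m > s\<close> are found at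
  position \<open>m - 1\<close>.
\<close>

definition inactive_mat ::
  "nat \<Rightarrow> (nat \<Rightarrow> nat) \<Rightarrow> nat \<Rightarrow> (nat \<Rightarrow> nat \<Rightarrow> real mat) \<Rightarrow> nat \<Rightarrow> nat \<Rightarrow> real mat" where
  "inactive_mat d n R F s \<beta> = lex_mat (remove_nth s (grid_dims d n)) [R]
     (\<lambda>is as. \<Prod>m\<in>{..<d} - {s}. F m \<beta> $$ (is ! (if m < s then m else m - 1), as ! 0))"

definition direction_mat ::
  "nat \<Rightarrow> (nat \<Rightarrow> nat) \<Rightarrow> nat \<Rightarrow> (nat \<Rightarrow> nat \<Rightarrow> real mat) \<Rightarrow> nat \<Rightarrow> nat \<Rightarrow> real mat" where
  "direction_mat d n R F s \<beta> = lex_mat (grid_dims d n) [n s, R]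
     (\<lambda>is ja. (if is ! s = ja ! 0 then 1 else 0) *
        inactive_mat d n R F s \<beta>
          $$ (lex_index (remove_nth s (grid_dims d n)) (remove_nth s is), ja ! 1))"

definition compressed_gramian ::
  "nat \<Rightarrow> (nat \<Rightarrow> nat) \<Rightarrow> nat \<Rightarrow> (nat \<Rightarrow> nat \<Rightarrow> real mat) \<Rightarrow> nat \<Rightarrow> nat \<Rightarrow> nat \<Rightarrow> nat \<Rightarrow> real mat" where
  "compressed_gramian d n R F s t \<beta> \<gamma> = (1 / real (grid_size d n)) \<cdot>\<^sub>m
     (transpose_mat (direction_mat d n R F s \<beta>) * direction_mat d n R F t \<gamma>)"

definition cross_gram ::
  "(nat \<Rightarrow> nat) \<Rightarrow> (nat \<Rightarrow> nat \<Rightarrow> real mat) \<Rightarrow> nat \<Rightarrow> nat \<Rightarrow> nat \<Rightarrow> real mat" where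
  "cross_gram n F \<beta> \<gamma> m = (1 / real (n m)) \<cdot>\<^sub>m (transpose_mat (F m \<beta>) * F m \<gamma>)"

lemma inactive_mat_entry:
  assumes "is \<in> multi_indices (grid_dims d n)" "s < d" "\<alpha> < R"
  shows "inactive_mat d n R F s \<beta>
           $$ (lex_index (remove_nth s (grid_dims d n)) (remove_nth s is), \<alpha>)
         = (\<Prod>m\<in>{..<d} - {s}. F m \<beta> $$ (is ! m, \<alpha>))"
proof -
  have l: "length is = d" and b: "\<And>k. k < d \<Longrightarrow> is ! k < grid_dims d n ! k"
    using assms(1) by (auto simp: multi_indices_def grid_dims_def)
  have r: "remove_nth s is \<in> multi_indices (remove_nth s (grid_dims d n))"
    using l b assms(2)
    by (auto simp: multi_indices_def remove_nth_def nth_append grid_dims_def min_def)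
  have a: "[\<alpha>] \<in> multi_indices [R]" using assms(3) by (simp add: multi_indices_def)
  have nth: "remove_nth s is ! (if m < s then m else m - 1) = is ! m"
    if "m < d" "m \<noteq> s" for m
    using that l assms(2) by (auto simp: remove_nth_def nth_append)
  have "lex_index [R] [\<alpha>] = \<alpha>" by (simp add: lex_index_def)
  then have "inactive_mat d n R F s \<beta>
           $$ (lex_index (remove_nth s (grid_dims d n)) (remove_nth s is), \<alpha>)
      = (\<Prod>m\<in>{..<d} - {s}.
           F m \<beta> $$ (remove_nth s is ! (if m < s then m else m - 1), [\<alpha>] ! 0))"
    using index_lex_mat[OF r a,
        of "\<lambda>is as. \<Prod>m\<in>{..<d} - {s}. F m \<beta> $$ (is ! (if m < s then m else m - 1), as ! 0)"]
    unfolding inactive_mat_def by (simp only:)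
  also have "\<dots> = (\<Prod>m\<in>{..<d} - {s}. F m \<beta> $$ (is ! m, \<alpha>))"
    by (rule prod.cong) (use nth in auto)
  finally show ?thesis .
qed

lemma direction_mat_entry:
  assumes "is \<in> multi_indices (grid_dims d n)" "s < d" "j < n s" "\<alpha> < R"
  shows "direction_mat d n R F s \<beta> $$ (lex_index (grid_dims d n) is, lex_index [n s, R] [j, \<alpha>])
         = (if is ! s = j then 1 else 0) *
           inactive_mat d n R F s \<beta>
             $$ (lex_index (remove_nth s (grid_dims d n)) (remove_nth s is), \<alpha>)"
proof -
  have "[j, \<alpha>] \<in> multi_indices [n s, R]"
    using assms by (auto simp: multi_indices_Cons multi_indices_Nil)
  then show ?thesis
    unfolding direction_mat_def index_lex_mat[OF assms(1) \<open>[j, \<alpha>] \<in> _\<close>] by simp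
qed

end

theory Submission
  imports Defs
begin

text \<open>
  Each entry of a compressed Gramian block is an average over the tensor grid of a function that
  factors over the coordinates, where the Kronecker deltas of the direction matrices are absorbed
  into the factors \<open>s\<close> and \<open>t\<close>. It is therefore a product of univariate averages: a coordinate
  \<open>m \<notin> {s, t}\<close> contributes an entry of the cross-Gram matrix, and a delta collapses the average
  of its own coordinate to a single term.
\<close>

text \<open>Distributivity: expanding the right-hand product selects one index per coordinate, and
  these selections are the multi-indices. The induction splits off the first coordinate;
  \<open>f\<close> is arbitrary because the tail sees its coordinates shifted by
  \<open>Suc\<close>.\<close>

lemma sum_multi_indices_prod:
  fixes f :: "nat \<Rightarrow> nat \<Rightarrow> 'a::comm_semiring_1"
  shows "(\<Sum>is\<in>multi_indices ns. \<Prod>k<length ns. f k (is ! k)) = (\<Prod>k<length ns. \<Sum>i<ns ! k. f k i)"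
proof (induction ns arbitrary: f)
  case Nil
  then show ?case by (simp add: multi_indices_Nil)
next
  case (Cons n ns)
  have image: "multi_indices (n # ns) = (\<lambda>(i, is). i # is) ` ({..<n} \<times> multi_indices ns)"
    by (auto simp: multi_indices_Cons)
  have inj: "inj_on (\<lambda>(i, is). i # is) ({..<n} \<times> multi_indices ns)"
    by (auto simp: inj_on_def)
  have "(\<Sum>is\<in>multi_indices (n # ns). \<Prod>k<length (n # ns). f k (is ! k))
      = (\<Sum>(i, is)\<in>{..<n} \<times> multi_indices ns. f 0 i * (\<Prod>k<length ns. f (Suc k) (is ! k)))"
    unfolding image sum.reindex[OF inj]
    by (intro sum.cong) (auto simp: prod.lessThan_Suc_shift simp del: prod.lessThan_Suc)
  also have "\<dots> = (\<Sum>i<n. f 0 i) * (\<Sum>is\<in>multi_indices ns. \<Prod>k<length ns. f (Suc k) (is ! k))"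
    by (simp add: sum_product sum.cartesian_product)
  also have "\<dots> = (\<Prod>k<length (n # ns). \<Sum>i<(n # ns) ! k. f k i)"
    using Cons.IH[of "\<lambda>k. f (Suc k)"]
    by (simp add: prod.lessThan_Suc_shift del: prod.lessThan_Suc)
  finally show ?case .
qed

lemma prod_list_grid_dims: "prod_list (grid_dims d n) = grid_size d n"
  by (induction d) (simp_all add: grid_dims_def grid_size_def)

lemma dim_direction_mat [simp]:
  "dim_row (direction_mat d n R F s \<beta>) = grid_size d n"
  "dim_col (direction_mat d n R F s \<beta>) = n s * R"
  by (simp_all add: direction_mat_def lex_mat_def prod_list_grid_dims)

lemma dim_compressed_gramian [simp]:
  "dim_row (compressed_gramian d n R F s t \<beta> \<gamma>) = n s * R"
  "dim_col (compressed_gramian d n R F s t \<beta> \<gamma>) = n t * R"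
  by (simp_all add: compressed_gramian_def)

lemma pair_lex_index:
  assumes "p < a * b"
  obtains i j where "i < a" "j < b" "p = lex_index [a, b] [i, j]"
  using lex_index_surj[of p "[a, b]"] assms
  by (auto simp: multi_indices_Cons multi_indices_Nil)

lemma pair_lex_index_less: "i < a \<Longrightarrow> j < b \<Longrightarrow> lex_index [a, b] [i, j] < a * b"
  using lex_index_less[of "[i, j]" "[a, b]"]
  by (simp add: multi_indices_Cons multi_indices_Nil)

text \<open>The delta stands in for the factor that the inactive contraction omits at
  \<open>m = s\<close>, so that an entry of a direction matrix becomes a product over all
  \<open>d\<close> coordinates.\<close>

definition slot_factor ::
  "(nat \<Rightarrow> nat \<Rightarrow> real mat) \<Rightarrow> nat \<Rightarrow> nat \<Rightarrow> nat \<Rightarrow> nat \<Rightarrow> nat \<Rightarrow> nat \<Rightarrow> real" where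
  "slot_factor F s \<beta> i \<alpha> m k = (if m = s then of_bool (k = i) else F m \<beta> $$ (k, \<alpha>))"

lemma direction_mat_prod:
  assumes "is \<in> multi_indices (grid_dims d n)" "s < d" "i < n s" "\<alpha> < R"
  shows "direction_mat d n R F s \<beta> $$ (lex_index (grid_dims d n) is, lex_index [n s, R] [i, \<alpha>])
       = (\<Prod>m<d. slot_factor F s \<beta> i \<alpha> m (is ! m))"
  using assms
  by (simp add: direction_mat_entry inactive_mat_entry prod.remove[of "{..<d}" s] slot_factor_def)

text \<open>A row of a direction matrix is a grid point and each summand is a product over
  coordinates, so \<open>sum_multi_indices_prod\<close> exchanges sum and product. The formula
  covers equal and distinct \<open>s\<close>, \<open>t\<close> alike; the two cases differ in how
  the deltas collapse.\<close>

lemma compressed_gramian_entry: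
  assumes "s < d" "t < d" "i < n s" "j < n t" "\<alpha> < R" "\<alpha>' < R"
  shows "compressed_gramian d n R F s t \<beta> \<gamma> $$ (lex_index [n s, R] [i, \<alpha>], lex_index [n t, R] [j, \<alpha>'])
       = (\<Prod>m<d. (\<Sum>k<n m. slot_factor F s \<beta> i \<alpha> m k * slot_factor F t \<gamma> j \<alpha>' m k) / real (n m))"
proof -
  let ?g = "grid_dims d n"
  let ?P = "direction_mat d n R F s \<beta>" and ?Q = "direction_mat d n R F t \<gamma>"
  let ?p = "lex_index [n s, R] [i, \<alpha>]" and ?q = "lex_index [n t, R] [j, \<alpha>']"
  let ?h = "\<lambda>m k. slot_factor F s \<beta> i \<alpha> m k * slot_factor F t \<gamma> j \<alpha>' m k"
  have pq: "?p < n s * R" "?q < n t * R"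
    using assms by (simp_all add: pair_lex_index_less)
  have "(transpose_mat ?P * ?Q) $$ (?p, ?q) = (\<Sum>r<grid_size d n. ?P $$ (r, ?p) * ?Q $$ (r, ?q))"
    using pq by (simp add: scalar_prod_def atLeast0LessThan)
  \<comment> \<open>Row numbers are traded for multi-indices through the bijection
    \<open>lex_index\<close>.\<close>
  also have "\<dots> = (\<Sum>is\<in>multi_indices ?g. ?P $$ (lex_index ?g is, ?p) * ?Q $$ (lex_index ?g is, ?q))"
    using sum.reindex_bij_betw[OF bij_betw_lex_index, of "\<lambda>r. ?P $$ (r, ?p) * ?Q $$ (r, ?q)" ?g]
    by (simp add: prod_list_grid_dims)
  also have "\<dots> = (\<Sum>is\<in>multi_indices ?g. \<Prod>m<d. ?h m (is ! m))"
    using assms by (intro sum.cong) (simp_all add: direction_mat_prod prod.distrib)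
  also have "\<dots> = (\<Prod>m<d. \<Sum>k<n m. ?h m k)"
    using sum_multi_indices_prod[of ?h ?g] by (simp add: grid_dims_def)
  \<comment> \<open>The grid size is itself a product over coordinates, so each univariate sum
    receives its own divisor \<open>n m\<close>.\<close>
  finally show ?thesis
    using pq by (simp add: compressed_gramian_def grid_size_def prod_dividef)
qed

lemma cross_gram_entry:
  assumes "\<And>\<beta>. F m \<beta> \<in> carrier_mat (n m) R" "\<alpha> < R" "\<alpha>' < R"
  shows "cross_gram n F \<beta> \<gamma> m $$ (\<alpha>, \<alpha>')
       = (\<Sum>k<n m. F m \<beta> $$ (k, \<alpha>) * F m \<gamma> $$ (k, \<alpha>')) / real (n m)"
proof -
  have "dim_row (F m \<beta>) = n m" "dim_col (F m \<beta>) = R" for \<beta>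
    using assms(1) by auto
  then show ?thesis
    using assms(2,3) by (simp add: cross_gram_def scalar_prod_def atLeast0LessThan)
qed

text \<open>Both deltas sit in coordinate \<open>s\<close>: no factor matrix survives there, and
  their sum is 1 exactly when \<open>i = j\<close>. This leaves the divisor \<open>n s\<close> and
  the cross-Gram entries of the other coordinates.\<close>

lemma compressed_gramian_entry_diag:
  assumes F: "\<And>m \<beta>. m < d \<Longrightarrow> F m \<beta> \<in> carrier_mat (n m) R"
    and "s < d" "i < n s" "j < n s" "\<alpha> < R" "\<alpha>' < R"
  shows "compressed_gramian d n R F s s \<beta> \<gamma> $$ (lex_index [n s, R] [i, \<alpha>], lex_index [n s, R] [j, \<alpha>'])
       = of_bool (i = j) / real (n s) * hadamard_prod R ({..<d} - {s}) (cross_gram n F \<beta> \<gamma>) $$ (\<alpha>, \<alpha>')"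
proof -
  have "(\<Sum>k<n s. slot_factor F s \<beta> i \<alpha> s k * slot_factor F s \<gamma> j \<alpha>' s k) = of_bool (i = j)"
    using assms by (simp add: slot_factor_def of_bool_def if_distrib[of "\<lambda>x. x * _"] sum.delta cong: if_cong)
  \<comment> \<open>\<open>R\<close> occurs in the premises of \<open>cross_gram_entry\<close> but
    not in its equation, so matching cannot find it and it is instantiated by hand.\<close>
  moreover have "(\<Prod>m\<in>{..<d} - {s}. (\<Sum>k<n m. slot_factor F s \<beta> i \<alpha> m k * slot_factor F s \<gamma> j \<alpha>' m k) / real (n m))
      = hadamard_prod R ({..<d} - {s}) (cross_gram n F \<beta> \<gamma>) $$ (\<alpha>, \<alpha>')"
    using assms by (auto simp: hadamard_prod_def cross_gram_entry[where R = R] slot_factor_def intro!: prod.cong)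
  ultimately show ?thesis
    using assms by (simp add: compressed_gramian_entry prod.remove[of "{..<d}" s])
qed

text \<open>The roles cross: in coordinate \<open>s\<close> the delta comes from the left direction
  matrix and selects row \<open>i\<close> of the right factor \<open>F s \<gamma>\<close>, while in
  coordinate \<open>t\<close> the right delta selects row \<open>j\<close> of the left factor
  \<open>F t \<beta>\<close>.\<close>

lemma compressed_gramian_entry_offdiag:
  assumes F: "\<And>m \<beta>. m < d \<Longrightarrow> F m \<beta> \<in> carrier_mat (n m) R"
    and "s < d" "t < d" "s \<noteq> t" "i < n s" "j < n t" "\<alpha> < R" "\<alpha>' < R"
  shows "compressed_gramian d n R F s t \<beta> \<gamma> $$ (lex_index [n s, R] [i, \<alpha>], lex_index [n t, R] [j, \<alpha>'])
       = F t \<beta> $$ (j, \<alpha>) * hadamard_prod R ({..<d} - {s, t}) (cross_gram n F \<beta> \<gamma>) $$ (\<alpha>, \<alpha>')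
           * F s \<gamma> $$ (i, \<alpha>') / (real (n s) * real (n t))"
proof -
  let ?f = "\<lambda>m. (\<Sum>k<n m. slot_factor F s \<beta> i \<alpha> m k * slot_factor F t \<gamma> j \<alpha>' m k) / real (n m)"
  have "?f s = F s \<gamma> $$ (i, \<alpha>') / real (n s)" "?f t = F t \<beta> $$ (j, \<alpha>) / real (n t)"
    using assms
    by (simp_all add: slot_factor_def of_bool_def if_distrib[of "\<lambda>x. x * _"] if_distrib[of "\<lambda>x. _ * x"]
        sum.delta cong: if_cong)
  moreover have "(\<Prod>m\<in>{..<d} - {s, t}. ?f m)
      = hadamard_prod R ({..<d} - {s, t}) (cross_gram n F \<beta> \<gamma>) $$ (\<alpha>, \<alpha>')"
    using assms by (auto simp: hadamard_prod_def cross_gram_entry[where R = R] slot_factor_def intro!: prod.cong)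
  \<comment> \<open>As \<open>s\<close> and \<open>t\<close> differ, \<open>t\<close> is still
    present after \<open>s\<close> has been split off.\<close>
  moreover have "(\<Prod>m<d. ?f m) = ?f s * (?f t * (\<Prod>m\<in>{..<d} - {s, t}. ?f m))"
    using assms prod.remove[of "{..<d}" s ?f] prod.remove[of "{..<d} - {s}" t ?f]
    by (simp add: Diff_insert2[symmetric] insert_commute)
  ultimately show ?thesis
    using assms by (simp add: compressed_gramian_entry)
qed

lemma compressed_gramian_diag:
  assumes F: "\<And>m \<beta>. m < d \<Longrightarrow> F m \<beta> \<in> carrier_mat (n m) R" and "s < d"
  shows "compressed_gramian d n R F s s \<beta> \<gamma> =
    ((1 / real (n s)) \<cdot>\<^sub>m 1\<^sub>m (n s)) \<otimes>\<^sub>K hadamard_prod R ({..<d} - {s}) (cross_gram n F \<beta> \<gamma>)"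
    (is "_ = ?I \<otimes>\<^sub>K ?M")
proof (rule eq_matI)
  have M: "dim_row ?M = R" "dim_col ?M = R" by (simp_all add: hadamard_prod_def)
  show "dim_row (compressed_gramian d n R F s s \<beta> \<gamma>) = dim_row (?I \<otimes>\<^sub>K ?M)"
    and "dim_col (compressed_gramian d n R F s s \<beta> \<gamma>) = dim_col (?I \<otimes>\<^sub>K ?M)"
    by (simp_all add: kron_def lex_mat_def M)
  fix p q assume "p < dim_row (?I \<otimes>\<^sub>K ?M)" "q < dim_col (?I \<otimes>\<^sub>K ?M)"
  then have "p < n s * R" "q < n s * R" by (simp_all add: kron_def lex_mat_def M)
  \<comment> \<open>Decoding both positions into pairs makes
    \<open>compressed_gramian_entry_diag\<close> and \<open>index_lex_mat\<close>
    applicable.\<close>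
  then obtain i \<alpha> j \<alpha>' where i: "i < n s" "\<alpha> < R" "p = lex_index [n s, R] [i, \<alpha>]"
    and j: "j < n s" "\<alpha>' < R" "q = lex_index [n s, R] [j, \<alpha>']"
    by (metis pair_lex_index)
  have "[i, \<alpha>] \<in> multi_indices [n s, R]" "[j, \<alpha>'] \<in> multi_indices [n s, R]"
    using i j by (simp_all add: multi_indices_Cons multi_indices_Nil)
  then have "(?I \<otimes>\<^sub>K ?M) $$ (p, q) = ?I $$ (i, j) * ?M $$ (\<alpha>, \<alpha>')"
    using i j by (simp add: kron_def M index_lex_mat)
  then show "compressed_gramian d n R F s s \<beta> \<gamma> $$ (p, q) = (?I \<otimes>\<^sub>K ?M) $$ (p, q)"
    using i j assms by (simp add: compressed_gramian_entry_diag)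
qed

lemma compressed_gramian_offdiag:
  assumes F: "\<And>m \<beta>. m < d \<Longrightarrow> F m \<beta> \<in> carrier_mat (n m) R"
    and "s < d" "t < d" "s \<noteq> t" "i < n s" "j < n t"
  shows "rank_block (n s) (n t) R (compressed_gramian d n R F s t \<beta> \<gamma>) i j =
    (1 / (real (n s) * real (n t))) \<cdot>\<^sub>m
      (Diag (row (F t \<beta>) j) * hadamard_prod R ({..<d} - {s, t}) (cross_gram n F \<beta> \<gamma>) *
       Diag (row (F s \<gamma>) i))" (is "_ = _ \<cdot>\<^sub>m (_ * ?M * _)")
proof -
  have dims: "dim_row (F m \<beta>) = n m" "dim_col (F m \<beta>) = R" if "m < d" for m \<beta>
    using F[OF that] by auto
  have M: "?M \<in> carrier_mat R R" by (simp add: hadamard_prod_def)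
  \<comment> \<open>A diagonal matrix scales rows from the left and columns from the right, which
    yields the factors in \<alpha> and \<alpha>' of the entry formula.\<close>
  have "Diag (row (F t \<beta>) j) * ?M * Diag (row (F s \<gamma>) i)
      = mat R R (\<lambda>(\<alpha>, \<alpha>'). F t \<beta> $$ (j, \<alpha>) * ?M $$ (\<alpha>, \<alpha>') * F s \<gamma> $$ (i, \<alpha>'))"
    using assms by (auto simp: Diag_def dims mat_diag_mult_left[OF M] mat_diag_mult_right[where nr = R])
  then show ?thesis
    using assms by (auto simp: rank_block_def compressed_gramian_entry_offdiag)
qed

text \<open>Transposing a product of the form \<open>transpose_mat P * Q\<close> exchanges
  \<open>P\<close> and \<open>Q\<close>; entrywise this is commutativity of real
  multiplication.\<close>

lemma transpose_compressed_gramian: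
  "transpose_mat (compressed_gramian d n R F s t \<beta> \<gamma>) = compressed_gramian d n R F t s \<gamma> \<beta>"
  by (intro eq_matI) (simp_all add: compressed_gramian_def scalar_prod_def mult.commute)

theorem theorem4p1:
  fixes d R RA :: nat
    and D :: "nat \<Rightarrow> real set"
    and H :: "nat \<Rightarrow> (real \<Rightarrow> real) set"
    and ip :: "nat \<Rightarrow> (real \<Rightarrow> real) \<Rightarrow> (real \<Rightarrow> real) \<Rightarrow> real"
    and u :: "nat \<Rightarrow> nat \<Rightarrow> 'p \<Rightarrow> real \<Rightarrow> real"
    and \<theta> :: "nat \<Rightarrow> 'p"
    and u\<theta> :: "(nat \<Rightarrow> real) \<Rightarrow> real"
    and A :: "nat \<Rightarrow> nat \<Rightarrow> (real \<Rightarrow> real) \<Rightarrow> (real \<Rightarrow> real)"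
    and \<A> :: "((nat \<Rightarrow> real) \<Rightarrow> real) \<Rightarrow> ((nat \<Rightarrow> real) \<Rightarrow> real)"
    and n :: "nat \<Rightarrow> nat"
    and z :: "nat \<Rightarrow> nat \<Rightarrow> real"
    and F :: "nat \<Rightarrow> nat \<Rightarrow> real mat"
  assumes "1 \<le> d" and "1 \<le> R" and "1 \<le> RA"
    and interval: "\<And>m. m < d \<Longrightarrow> \<exists>a b. a < b \<and> D m = {a<..<b}"
    and hilbert: "\<And>m. m < d \<Longrightarrow> hilbert_embedded_L2 (D m) (H m) (ip m)"
    and network: "\<And>m \<alpha>. m < d \<Longrightarrow> \<alpha> < R \<Longrightarrow> u m \<alpha> (\<theta> m) \<in> H m"
    and ansatz: "u\<theta> = separable_ansatz d R u \<theta>"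
    and factors: "\<And>m \<beta>. m < d \<Longrightarrow> \<beta> < RA \<Longrightarrow> bounded_linear_to_L2 (D m) (H m) (ip m) (A m \<beta>)"
    and operator: "separable_operator d RA D H A \<A>"
    and continuous: "\<And>m \<beta> \<alpha>. m < d \<Longrightarrow> \<beta> < RA \<Longrightarrow> \<alpha> < R \<Longrightarrow>
        \<exists>g. is_cont_rep (D m) (A m \<beta> (u m \<alpha> (\<theta> m))) g"
    and grid_nonempty: "\<And>m. m < d \<Longrightarrow> 1 \<le> n m"
    and grid: "\<And>m i. m < d \<Longrightarrow> i < n m \<Longrightarrow> z m i \<in> D m"
    and F: "F = factor_mat D n R z A u \<theta>"
  shows
    "(\<forall>s<d. \<forall>\<beta><RA. \<forall>\<gamma><RA.
        compressed_gramian d n R F s s \<beta> \<gamma> \<in> carrier_mat (n s * R) (n s * R) \<and>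
        compressed_gramian d n R F s s \<beta> \<gamma> =
          ((1 / real (n s)) \<cdot>\<^sub>m 1\<^sub>m (n s)) \<otimes>\<^sub>K
            hadamard_prod R ({..<d} - {s}) (cross_gram n F \<beta> \<gamma>)) \<and>
     (\<forall>t<d. \<forall>s<t. \<forall>\<beta><RA. \<forall>\<gamma><RA.
        (\<forall>i<n s. \<forall>j<n t.
           rank_block (n s) (n t) R (compressed_gramian d n R F s t \<beta> \<gamma>) i j =
             (1 / (real (n s) * real (n t))) \<cdot>\<^sub>m
               (Diag (row (F t \<beta>) j) *
                hadamard_prod R ({..<d} - {s, t}) (cross_gram n F \<beta> \<gamma>) *
                Diag (row (F s \<gamma>) i))) \<and>
        compressed_gramian d n R F t s \<gamma> \<beta> =
          transpose_mat (compressed_gramian d n R F s t \<beta> \<gamma>))"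
proof -
  have "F m \<beta> \<in> carrier_mat (n m) R" for m \<beta>
    by (simp add: F factor_mat_def)
  \<comment> \<open>The diagonal formula is applied from right to left, turning its Kronecker
    product back into the Gramian. The Gramian thus stays visible to the dimension rules that settle
    the carrier claim.\<close>
  then show ?thesis
    by (auto simp: compressed_gramian_diag[symmetric] compressed_gramian_offdiag
        transpose_compressed_gramian intro: carrier_matI)
qed

end
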